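(* Let $a,b:[0,\infty)\to\mathbb{R}$ be positive continuous functions with $b$ non-decreasing, let $g:[0,\infty)\to\mathbb{R}$ be continuous and nonnegative, and let $x_0>0$. Suppose that $b$ is sub-multiplicative with constant $c>0$, that is, $b(xy)\le c\,b(x)\,b(y)$ for every $x,y\ge0$. Let $T_e$ be the time of explosion of the solution $Y$ of $$Y_t=x_0+\int_0^t a(s)\,b(Y_s+g(s))\,ds,\quad t\ge0.$$ Then $T_e\ge\widetilde{A}^{-1}(B(\infty))$.
   Context: $B(\infty)=\int_{x_0}^\infty\frac{ds}{b(s)}\in(0,\infty]$, and $\widetilde{A}:[0,\infty)\to\mathbb{R}$ is $$\widetilde{A}(t)=c\int_0^t a(s)\,b\Bigl(\frac{1}{x_0}g(s)+1\Bigr)ds,$$ which is continuous and strictly increasing, with limit $\widetilde{A}(\infty)\in(0,\infty]$ at $\infty$. Convention: $\widetilde{A}^{-1}(s)=\infty$ if $s\ge\widetilde{A}(\infty)$. The solution $Y$ is a maximal continuous solution of the integral equation, assigned the value $\infty$ from the moment it becomes infinite, and $T_e=\sup\{t\ge0:Y_t<\infty\}\in[0,\infty]$. *)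

theory Defs
  imports "HOL-Analysis.Analysis"
begin

text \<open>
  The coefficients \<open>a\<close>, \<open>b\<close>, \<open>g\<close> are functions on \<open>[0, \<infinity>)\<close>; their values at negative
  arguments are irrelevant. This is why a solution is required to keep the argument of
  \<open>b\<close> nonnegative.
\<close>

definition solves_on ::
    "(real \<Rightarrow> real) \<Rightarrow> (real \<Rightarrow> real) \<Rightarrow> (real \<Rightarrow> real) \<Rightarrow> real \<Rightarrow> real set \<Rightarrow> (real \<Rightarrow> real) \<Rightarrow> bool"
  where
  "solves_on a b g x0 J y \<longleftrightarrow>
     continuous_on J y \<and>
     (\<forall>t\<in>J. 0 \<le> y t + g t) \<and>
     (\<forall>t\<in>J. y t = x0 + integral {0..t} (\<lambda>s. a s * b (y s + g s)))"

definition upto_time :: "ereal \<Rightarrow> real set"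
  where "upto_time T = {t. 0 \<le> t \<and> ereal t < T}"

text \<open>
  Maximality means that the solution on \<open>[0, T)\<close> has no extension to a solution on a
  larger interval \<open>[0, T')\<close>. Divergence to \<open>\<infinity>\<close> at a finite \<open>T\<close> is not assumed: it is a
  consequence of maximality. Uniqueness is not assumed either, as \<open>b\<close> need not be
  locally Lipschitz.
\<close>

definition maximal_solution ::
    "(real \<Rightarrow> real) \<Rightarrow> (real \<Rightarrow> real) \<Rightarrow> (real \<Rightarrow> real) \<Rightarrow> real \<Rightarrow> (real \<Rightarrow> ereal) \<Rightarrow> bool"
  where
  "maximal_solution a b g x0 Y \<longleftrightarrow>
     (\<exists>T y. 0 < T \<and>
        solves_on a b g x0 (upto_time T) y \<and>
        \<not> (\<exists>T' z. T < T' \<and> solves_on a b g x0 (upto_time T') z \<and>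
                 (\<forall>t\<in>upto_time T. z t = y t)) \<and>
        (\<forall>t\<ge>0. Y t = (if ereal t < T then ereal (y t) else \<infinity>)))"

definition explosion_time :: "(real \<Rightarrow> ereal) \<Rightarrow> ereal"
  where "explosion_time Y = Sup (ereal ` {t. 0 \<le> t \<and> Y t < \<infinity>})"

definition B_infinity :: "(real \<Rightarrow> real) \<Rightarrow> real \<Rightarrow> ereal"
  where "B_infinity b x0 = enn2ereal (\<integral>\<^sup>+ s\<in>{x0..}. ennreal (1 / b s) \<partial>lborel)"

definition A_tilde ::
    "(real \<Rightarrow> real) \<Rightarrow> (real \<Rightarrow> real) \<Rightarrow> (real \<Rightarrow> real) \<Rightarrow> real \<Rightarrow> real \<Rightarrow> real \<Rightarrow> real"
  where
  "A_tilde a b g x0 c t = c * integral {0..t} (\<lambda>s. a s * b ((1 / x0) * g s + 1))"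

definition limit_at_infinity :: "(real \<Rightarrow> real) \<Rightarrow> ereal"
  where "limit_at_infinity f = Lim at_top (\<lambda>t. ereal (f t))"

text \<open>
  The inverse of a continuous, strictly increasing function on \<open>[0, \<infinity>)\<close> vanishing at \<open>0\<close>,
  for arguments in \<open>[0, \<infinity>]\<close>.
\<close>

definition extended_inverse :: "(real \<Rightarrow> real) \<Rightarrow> ereal \<Rightarrow> ereal"
  where
  "extended_inverse f s =
     (if limit_at_infinity f \<le> s then \<infinity>
      else ereal (inv_into {0..} f (real_of_ereal s)))"

end

theory Submission
  imports Defs
begin

text \<open>
  If \<open>y\<close> solves the equation, sub-multiplicativity gives
  \<open>b (y + g) = b (y * (1 + g / y)) \<le> c * b y * b (1 + g / x0)\<close> because \<open>y \<ge> x0\<close>. Dividing \<open>y'\<close> by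
  \<open>b y\<close> and integrating bounds the integral of \<open>1 / b\<close> from \<open>x0\<close> to \<open>y t\<close> by \<open>A_tilde t\<close>.
  If the solution ended at a finite \<open>T\<close> with \<open>A_tilde T < B(\<infinity>)\<close>, it would thus be bounded
  on \<open>[0, T)\<close>, extend continuously to \<open>T\<close>, and continue beyond \<open>T\<close>, against maximality.
  As \<open>b\<close> is monotone, continuation needs no compactness argument: Picard iteration from the
  constant function is increasing, so it converges to a solution.
\<close>

section \<open>Solution intervals, explosion time and the extended inverse\<close>

lemma solves_on_subset:
  assumes "solves_on a b g x0 J y" and "J' \<subseteq> J"
  shows "solves_on a b g x0 J' y"
  using assms continuous_on_subset unfolding solves_on_def by blast

lemma upto_time_ereal [simp]: "upto_time (ereal T) = {0..<T}"
  by (auto simp: upto_time_def)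

lemma explosion_time_eq:
  assumes "0 < T" and "\<And>t. 0 \<le> t \<Longrightarrow> Y t = (if ereal t < T then ereal (y t) else \<infinity>)"
  shows "explosion_time Y = T"
proof -
  have eq: "{t. 0 \<le> t \<and> Y t < \<infinity>} = {t. 0 \<le> t \<and> ereal t < T}"
    using assms(2) by (auto split: if_splits)
  have "Sup (ereal ` {t. 0 \<le> t \<and> ereal t < T}) = T"
  proof (rule antisym)
    show "Sup (ereal ` {t. 0 \<le> t \<and> ereal t < T}) \<le> T"
      by (rule Sup_least) auto
    show "T \<le> Sup (ereal ` {t. 0 \<le> t \<and> ereal t < T})"
    \<comment> \<open>Testing only numbers strictly between 0 and \<open>T\<close> suffices. Each of
      them is finite and nonnegative, hence in the set, even when \<open>T\<close> is
      infinite.\<close>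
    proof (rule dense_le_bounded[OF assms(1)])
      fix w assume w: "0 < w" "w < T"
      then obtain r where "w = ereal r" by (cases w) auto
      with w show "w \<le> Sup (ereal ` {t. 0 \<le> t \<and> ereal t < T})"
        by (intro Sup_upper) auto
    qed
  qed
  then show ?thesis
    unfolding explosion_time_def eq .
qed

text \<open>A monotone function converges in the extended reals to its supremum. This replaces the
  choice made by \<open>Lim\<close> with a quantity that can be compared with single values of
  \<open>f\<close>.\<close>

lemma limit_at_infinity_eq_SUP:
  assumes "mono_on {0..} f"
  shows "limit_at_infinity f = (SUP t\<in>{0..}. ereal (f t))"
proof -
  have "((\<lambda>t. ereal (f t)) \<longlongrightarrow> (SUP t\<in>{0..}. ereal (f t))) at_top"
  proof (rule increasing_tendsto)
    show "\<forall>\<^sub>F t in at_top. ereal (f t) \<le> (SUP t\<in>{0..}. ereal (f t))"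
      using eventually_ge_at_top[of 0] by eventually_elim (auto intro: SUP_upper)
  next
    fix x assume "x < (SUP t\<in>{0..}. ereal (f t))"
    then obtain t where t: "0 \<le> t" "x < ereal (f t)"
      by (auto simp: less_SUP_iff)
    show "\<forall>\<^sub>F s in at_top. x < ereal (f s)"
      using eventually_ge_at_top[of t]
    proof eventually_elim
      case (elim s)
      have "f t \<le> f s" using monotone_onD[OF assms, of t s] t elim by auto
      with t show ?case by (meson ereal_less_eq(3) less_le_trans)
    qed
  qed
  then show ?thesis
    unfolding limit_at_infinity_def by (intro tendsto_Lim) auto
qed

text \<open>If the inverse is infinite by convention, the claim follows from \<open>f\<close> lying
  strictly below its limit. Otherwise \<open>s\<close> is a value of \<open>f\<close>, and strict
  monotonicity at its preimage gives the claim.\<close>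

lemma less_of_less_extended_inverse:
  assumes cont: "\<And>u. continuous_on {0..u} f" and mono: "strict_mono_on {0..} f" and "f 0 = 0"
    and "0 \<le> s" and "0 \<le> t" and less: "ereal t < extended_inverse f s"
  shows "ereal (f t) < s"
proof -
  have lim: "limit_at_infinity f = (SUP t\<in>{0..}. ereal (f t))"
    by (rule limit_at_infinity_eq_SUP[OF strict_mono_on_imp_mono_on[OF mono]])
  show ?thesis
  proof (cases "limit_at_infinity f \<le> s")
    case True
    \<comment> \<open>\<open>s\<close> may equal the limit, so strictness has to come from the
      growth of \<open>f\<close> beyond \<open>t\<close>.\<close>
    have "ereal (f t) < ereal (f (t + 1))"
      using strict_mono_onD[OF mono, of t "t + 1"] \<open>0 \<le> t\<close> by simp
    also have "\<dots> \<le> limit_at_infinity f"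
      unfolding lim using \<open>0 \<le> t\<close> by (intro SUP_upper) auto
    finally show ?thesis using True by order
  next
    case False
    then obtain u where u: "0 \<le> u" "s < ereal (f u)"
      by (auto simp: lim less_SUP_iff not_le)
    with \<open>0 \<le> s\<close> obtain r where r: "s = ereal r" "0 \<le> r" "r < f u"
      by (cases s) auto
    \<comment> \<open>\<open>inv_into\<close> is meaningful only at attained values. Since
      \<open>f 0 = 0 \<le> r < f u\<close>, the intermediate value theorem shows that
      \<open>r\<close> is one.\<close>
    have "\<exists>x\<ge>0. x \<le> u \<and> f x = r"
      using r u \<open>f 0 = 0\<close> cont by (intro IVT') auto
    then have "r \<in> f ` {0..}" by auto
    then have inv: "f (inv_into {0..} f r) = r" "inv_into {0..} f r \<in> {0..}"
      by (rule f_inv_into_f, rule inv_into_into)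
    have "t < inv_into {0..} f r"
      using less False r by (simp add: extended_inverse_def)
    then have "f t < r"
      using strict_mono_onD[OF mono, of t "inv_into {0..} f r"] inv \<open>0 \<le> t\<close> by simp
    then show ?thesis by (simp add: r)
  qed
qed

section \<open>The improper integral of \<open>1 / b\<close>\<close>

lemma integral_has_real_derivative_atLeast:
  fixes f :: "real \<Rightarrow> real"
  assumes "continuous_on {a..} f" and "a < u"
  shows "((\<lambda>u. integral {a..u} f) has_real_derivative f u) (at u)"
proof -
  have "((\<lambda>u. integral {a..u} f) has_real_derivative f u) (at u within {a..u + 1})"
    using assms by (intro integral_has_real_derivative continuous_on_subset[OF assms(1)]) auto
  \<comment> \<open>Running the interval past \<open>u\<close> makes \<open>u\<close> an interior
    point, so the derivative is two-sided.\<close>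
  moreover have "at u within {a..u + 1} = at u"
    using assms by (intro at_within_interior) auto
  ultimately show ?thesis by simp
qed

text \<open>\<open>H\<close> is an increasing antiderivative of \<open>1 / b\<close>. Bounded by
  hypothesis, it has a finite limit \<open>l\<close>, and the fundamental theorem on a half-line
  identifies \<open>B_infinity b x0\<close> with \<open>l - H x0\<close>. The contrapositive later
  yields a finite \<open>u\<close> at which the integral already exceeds \<open>K\<close>.\<close>

lemma B_infinity_le:
  assumes cont: "continuous_on {0..} b" and pos: "\<And>x. 0 \<le> x \<Longrightarrow> 0 < b x" and "0 < x0"
    and le: "\<And>u. x0 \<le> u \<Longrightarrow>
      integral {0..u} (\<lambda>s. 1 / b s) - integral {0..x0} (\<lambda>s. 1 / b s) \<le> K"
  shows "B_infinity b x0 \<le> ereal K"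
proof -
  define H where "H u = integral {0..u} (\<lambda>s. 1 / b s)" for u
  define l where "l = (SUP u\<in>{x0..}. H u)"
  have inv_cont: "continuous_on {0..} (\<lambda>s. 1 / b s)"
    using cont pos by (intro continuous_intros) (auto simp: less_imp_neq[THEN not_sym])
  have deriv: "(H has_real_derivative 1 / b u) (at u)" if "x0 \<le> u" for u
    unfolding H_def using that \<open>0 < x0\<close> inv_cont
    by (intro integral_has_real_derivative_atLeast[of 0 "\<lambda>s. 1 / b s"]) auto
  have mono: "H u \<le> H v" if "x0 \<le> u" "u \<le> v" for u v
  proof (rule DERIV_nonneg_imp_nondecreasing[OF that(2)])
    fix x assume "u \<le> x" "x \<le> v"
    then show "\<exists>y. (H has_real_derivative y) (at x) \<and> 0 \<le> y"
      using that \<open>0 < x0\<close> pos[of x] deriv[of x] by (intro exI[of _ "1 / b x"]) auto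
  qed
  have H_le: "H u \<le> H x0 + K" if "x0 \<le> u" for u
    using le[OF that] by (simp add: H_def)
  then have bdd: "bdd_above (H ` {x0..})" by (intro bdd_aboveI) auto
  have l_le: "l \<le> H x0 + K"
    unfolding l_def using H_le by (intro cSUP_least) auto
  have lim: "(H \<longlongrightarrow> l) at_top"
  proof (rule increasing_tendsto)
    show "\<forall>\<^sub>F u in at_top. H u \<le> l"
      using eventually_ge_at_top[of x0]
      by eventually_elim (auto simp: l_def intro: cSUP_upper[OF _ bdd])
  next
    fix x assume "x < l"
    then obtain u where "x0 \<le> u" "x < H u"
      using less_cSUP_iff[OF _ bdd] by (auto simp: l_def)
    show "\<forall>\<^sub>F v in at_top. x < H v"
      using eventually_ge_at_top[of u]
    proof eventually_elim
      case (elim v)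
      then show ?case using mono[of u v] \<open>x0 \<le> u\<close> \<open>x < H u\<close> by simp
    qed
  qed
  \<comment> \<open>Nothing is known of \<open>b\<close> at negative arguments. Freezing the
    argument at 0 gives a function measurable on the whole line that agrees with
    \<open>1 / b\<close> on \<open>{x0..}\<close>.\<close>
  have "continuous_on UNIV (\<lambda>s. 1 / b (max 0 s))"
    by (rule continuous_on_compose2[OF inv_cont, of UNIV "max 0"])
      (auto intro: continuous_on_max continuous_on_const continuous_on_id)
  then have meas: "(\<lambda>s. 1 / b (max 0 s)) \<in> borel_measurable borel"
    by (rule borel_measurable_continuous_onI)
  have "(\<integral>\<^sup>+ s. ennreal (1 / b s) * indicator {x0..} s \<partial>lborel)
      = (\<integral>\<^sup>+ s. ennreal (1 / b (max 0 s)) * indicator {x0..} s \<partial>lborel)"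
    using \<open>0 < x0\<close> by (intro nn_integral_cong) (auto split: split_indicator simp: max_def)
  also have "\<dots> = ennreal (l - H x0)"
  proof (rule nn_integral_FTC_atLeast[OF meas _ _ lim])
    fix x assume "x0 \<le> x"
    then show "(H has_real_derivative 1 / b (max 0 x)) (at x)"
      using deriv[of x] \<open>0 < x0\<close> by (simp add: max_def)
    show "0 \<le> 1 / b (max 0 x)"
      using pos[of "max 0 x"] by simp
  qed
  \<comment> \<open>The maximum stems from \<open>ennreal\<close> truncating at 0. It is harmless
    because \<open>K\<close> is nonnegative, by the case \<open>u = x0\<close> of the
    hypothesis.\<close>
  finally have "B_infinity b x0 = ereal (max 0 (l - H x0))"
    by (simp add: B_infinity_def ennreal.rep_eq zero_ereal_def)
  moreover have "0 \<le> K" using le[of x0] by simp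
  ultimately show ?thesis using l_le by simp
qed

section \<open>Local existence and continuation of solutions\<close>

locale growth_coefficients =
  fixes a b g :: "real \<Rightarrow> real"
  assumes a_cont: "continuous_on {0..} a" and a_pos: "\<And>t. 0 \<le> t \<Longrightarrow> 0 < a t"
    and b_cont: "continuous_on {0..} b" and b_pos: "\<And>x. 0 \<le> x \<Longrightarrow> 0 < b x"
    and b_mono: "mono_on {0..} b"
    and g_cont: "continuous_on {0..} g" and g_nonneg: "\<And>t. 0 \<le> t \<Longrightarrow> 0 \<le> g t"
begin

lemma b_le: "0 \<le> x \<Longrightarrow> x \<le> y \<Longrightarrow> b x \<le> b y"
  using monotone_onD[OF b_mono, of x y] by auto

lemma integrand_cont:
  assumes "continuous_on J y" and "J \<subseteq> {0..}" and "\<And>t. t \<in> J \<Longrightarrow> 0 \<le> y t + g t"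
  shows "continuous_on J (\<lambda>s. a s * b (y s + g s))"
  using assms continuous_on_subset[OF a_cont] continuous_on_subset[OF g_cont]
  by (intro continuous_intros continuous_on_compose2[OF b_cont, of J "\<lambda>s. y s + g s"]) auto

text \<open>\<open>a\<close> and \<open>g\<close> attain their maxima on the compact interval, and
  monotonicity of \<open>b\<close> reduces all arguments to the largest one. The bound is uniform in
  \<open>x\<close>, so it applies to all Picard iterates at once.\<close>

lemma integrand_bound:
  assumes "0 \<le> T"
  obtains C where "0 \<le> C"
    and "\<And>s x. s \<in> {0..T} \<Longrightarrow> 0 \<le> x + g s \<Longrightarrow> x \<le> M \<Longrightarrow> \<bar>a s * b (x + g s)\<bar> \<le> C"
proof -
  have "\<exists>s\<in>{0..T}. \<forall>t\<in>{0..T}. a t \<le> a s" "\<exists>s\<in>{0..T}. \<forall>t\<in>{0..T}. g t \<le> g s"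
    using assms by (intro continuous_attains_sup continuous_on_subset[OF a_cont]
        continuous_on_subset[OF g_cont]; auto)+
  then obtain p q where p: "p \<in> {0..T}" "\<And>t. t \<in> {0..T} \<Longrightarrow> a t \<le> a p"
    and q: "q \<in> {0..T}" "\<And>t. t \<in> {0..T} \<Longrightarrow> g t \<le> g q"
    by blast
  \<comment> \<open>\<open>M\<close> may be negative; the maximum keeps \<open>N\<close> where
    \<open>b\<close> is known to be positive.\<close>
  define N where "N = max 0 (M + g q)"
  show ?thesis
  proof (rule that[of "a p * b N"])
    show "0 \<le> a p * b N"
      using a_pos[of p] b_pos[of N] p by (auto simp: N_def)
    fix s x assume s: "s \<in> {0..T}" "0 \<le> x + g s" "x \<le> M"
    then have "b (x + g s) \<le> b N"
      using q(2)[of s] by (intro b_le) (auto simp: N_def)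
    moreover have "0 < a s" "0 < b (x + g s)"
      using a_pos[of s] b_pos[of "x + g s"] s by auto
    ultimately show "\<bar>a s * b (x + g s)\<bar> \<le> a p * b N"
      using p(2)[OF s(1)] by (simp add: mult_mono)
  qed
qed

text \<open>All Picard iterates started at \<open>L\<close> stay between \<open>L\<close> and
  \<open>L + 1\<close> on a short interval, and they increase, so they converge pointwise. Dominated
  convergence carries the integral equation to the limit, and only then does the equation give
  continuity of \<open>w\<close>.\<close>

lemma local_solution:
  assumes "0 \<le> T" and "0 \<le> L"
  obtains d w where "0 < d" and "continuous_on {T..T + d} w"
    and "\<And>t. t \<in> {T..T + d} \<Longrightarrow> L \<le> w t"
    and "\<And>t. t \<in> {T..T + d} \<Longrightarrow> w t = L + integral {T..t} (\<lambda>s. a s * b (w s + g s))"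
proof -
  from \<open>0 \<le> T\<close> have "0 \<le> T + 1" by simp
  then obtain C where "0 \<le> C" and C: "\<And>s x. s \<in> {0..T + 1} \<Longrightarrow> 0 \<le> x + g s \<Longrightarrow> x \<le> L + 1 \<Longrightarrow>
      \<bar>a s * b (x + g s)\<bar> \<le> C"
    by (rule integrand_bound[where M = "L + 1"]) blast
  \<comment> \<open>\<open>C * d \<le> 1\<close> limits the rise of an iterate to 1, and
    \<open>d \<le> 1\<close> keeps the interval inside \<open>{0..T + 1}\<close>, where
    \<open>C\<close> is valid. The added 1 covers \<open>C = 0\<close>.\<close>
  define d where "d = 1 / (C + 1)"
  have d: "0 < d" "d \<le> 1" "C * d \<le> 1"
    using \<open>0 \<le> C\<close> by (auto simp: d_def field_simps)
  define I where "I = {T..T + d}"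
  define W where "W = rec_nat (\<lambda>t. L) (\<lambda>n w t. L + integral {T..t} (\<lambda>s. a s * b (w s + g s)))"
  define F where "F = (\<lambda>n s. a s * b (W n s + g s))"
  have W_0: "W 0 t = L" and W_Suc: "W (Suc n) t = L + integral {T..t} (F n)" for n t
    by (simp_all add: W_def F_def)
  have I_ge: "0 \<le> s \<and> s \<le> T + 1" if "s \<in> I" for s
    using that \<open>0 \<le> T\<close> d by (auto simp: I_def)
  \<comment> \<open>Continuity joins the induction because the bounds on the next iterate need
    \<open>F n\<close> to be integrable.\<close>
  have bounds: "continuous_on I (W n) \<and> (\<forall>t\<in>I. L \<le> W n t \<and> W n t \<le> L + 1)" for n
  proof (induction n)
    case 0
    then show ?case by (simp add: W_0)
  next
    case (Suc n)
    have F_cont: "continuous_on I (F n)"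
      unfolding F_def using Suc I_ge g_nonneg \<open>0 \<le> L\<close>
      by (intro integrand_cont) (fastforce intro: add_nonneg_nonneg)+
    have F_bound: "0 \<le> F n s \<and> F n s \<le> C" if "s \<in> I" for s
    proof -
      have "0 \<le> W n s + g s" "W n s \<le> L + 1" using Suc that I_ge[OF that] g_nonneg[of s] \<open>0 \<le> L\<close> by force+
      then show ?thesis
        using C[of s "W n s"] I_ge[OF that] a_pos[of s] b_pos[of "W n s + g s"]
        by (auto simp: F_def)
    qed
    have "0 \<le> integral {T..t} (F n) \<and> integral {T..t} (F n) \<le> 1" if t: "t \<in> I" for t
    proof -
      have sub: "{T..t} \<subseteq> I" using t by (auto simp: I_def)
      then have int: "F n integrable_on {T..t}"
        using continuous_on_subset[OF F_cont] by (intro integrable_continuous_interval) blast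
      have "integral {T..t} (F n) \<le> integral {T..t} (\<lambda>s. C)"
        using int sub F_bound by (intro integral_le) auto
      also have "\<dots> = C * (t - T)" using t by (simp add: I_def)
      also have "\<dots> \<le> C * d" using t \<open>0 \<le> C\<close> by (intro mult_left_mono) (auto simp: I_def)
      finally have "integral {T..t} (F n) \<le> 1" using d by simp
      moreover have "0 \<le> integral {T..t} (F n)"
        using sub F_bound by (intro integral_nonneg[OF int]) blast
      ultimately show ?thesis by simp
    qed
    moreover have "continuous_on I (\<lambda>t. integral {T..t} (F n))"
      using F_cont unfolding I_def
      by (intro indefinite_integral_continuous_1 integrable_continuous_interval)
    ultimately show ?case
      unfolding W_Suc by (intro conjI continuous_on_add continuous_on_const) auto
  qed
  have arg_nonneg: "0 \<le> W n s + g s" if "s \<in> I" for n s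
    using bounds[of n] that I_ge[OF that] g_nonneg[of s] \<open>0 \<le> L\<close> by force
  have F_bound: "\<bar>F n s\<bar> \<le> C" if "s \<in> I" for n s
    unfolding F_def using that I_ge arg_nonneg bounds[of n] by (intro C) auto
  have F_int: "F n integrable_on {T..t}" if "t \<in> I" for n t
  proof -
    have "{T..t} \<subseteq> I" using that by (auto simp: I_def)
    moreover have "continuous_on I (F n)"
      unfolding F_def using bounds I_ge arg_nonneg by (intro integrand_cont) auto
    ultimately show ?thesis
      using continuous_on_subset by (intro integrable_continuous_interval) blast
  qed
  \<comment> \<open>The lower bound \<open>L\<close> starts the induction; monotonicity of
    \<open>b\<close> passes the order from iterates to integrands.\<close>
  have step: "\<forall>t\<in>I. W n t \<le> W (Suc n) t" for n
  proof (induction n)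
    case 0
    then show ?case using bounds[of "Suc 0"] by (auto simp: W_0)
  next
    case (Suc n)
    have "F n s \<le> F (Suc n) s" if "s \<in> I" for s
      unfolding F_def using Suc that I_ge[OF that] arg_nonneg[OF that] a_pos[of s]
      by (intro mult_left_mono b_le) auto
    then have "integral {T..t} (F n) \<le> integral {T..t} (F (Suc n))" if "t \<in> I" for t
      using F_int that by (intro integral_le) (auto simp: I_def)
    then show ?case
      by (simp add: W_Suc)
  qed
  define w where "w t = lim (\<lambda>n. W n t)" for t
  have W_lim: "(\<lambda>n. W n t) \<longlonglongrightarrow> w t" if "t \<in> I" for t
  proof -
    have "incseq (\<lambda>n. W n t)" using step that by (intro incseq_SucI) auto
    moreover have "\<forall>n. W n t \<le> L + 1" using bounds that by blast
    ultimately obtain l where "(\<lambda>n. W n t) \<longlonglongrightarrow> l"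
      by (rule incseq_convergent)
    then show ?thesis unfolding w_def by (simp add: limI)
  qed
  have w_ge: "L \<le> w t" if "t \<in> I" for t
    using bounds that by (intro LIMSEQ_le_const[OF W_lim[OF that]]) auto
  define f where "f = (\<lambda>s. a s * b (w s + g s))"
  have F_lim: "(\<lambda>n. F n s) \<longlonglongrightarrow> f s" if s: "s \<in> I" for s
  proof -
    have "0 \<le> w s + g s" using w_ge[OF s] \<open>0 \<le> L\<close> g_nonneg[of s] I_ge[OF s] by simp
    then have "(\<lambda>n. b (W n s + g s)) \<longlonglongrightarrow> b (w s + g s)"
      using arg_nonneg[OF s] W_lim[OF s]
      by (intro continuous_on_tendsto_compose[OF b_cont] tendsto_intros) auto
    then show ?thesis unfolding F_def f_def by (intro tendsto_intros)
  qed
  have f_int: "f integrable_on {T..t}" "(\<lambda>n. integral {T..t} (F n)) \<longlonglongrightarrow> integral {T..t} f"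
    if "t \<in> I" for t
  proof -
    have sub: "{T..t} \<subseteq> I" using that by (auto simp: I_def)
    have "norm (F n s) \<le> C" "(\<lambda>n. F n s) \<longlonglongrightarrow> f s" if "s \<in> {T..t}" for n s
      using subsetD[OF sub that] F_bound F_lim by simp_all
    note dominated = dominated_convergence[OF F_int[OF that] integrable_const_ivl this]
    show "f integrable_on {T..t}" by (rule dominated)
    show "(\<lambda>n. integral {T..t} (F n)) \<longlonglongrightarrow> integral {T..t} f" by (rule dominated)
  qed
  have w_eq: "w t = L + integral {T..t} f" if "t \<in> I" for t
  proof (rule LIMSEQ_unique)
    show "(\<lambda>n. W (Suc n) t) \<longlonglongrightarrow> w t" using W_lim[OF that] by (rule LIMSEQ_Suc)
    show "(\<lambda>n. W (Suc n) t) \<longlonglongrightarrow> L + integral {T..t} f"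
      unfolding W_Suc by (intro tendsto_intros f_int that)
  qed
  \<comment> \<open>The right endpoint makes \<open>f\<close> integrable on all of \<open>I\<close>,
    so its indefinite integral, which equals \<open>w\<close> up to \<open>L\<close>, is
    continuous.\<close>
  have "T + d \<in> I" using d by (simp add: I_def)
  then have "continuous_on I (\<lambda>t. L + integral {T..t} f)"
    using f_int(1) unfolding I_def
    by (intro continuous_intros indefinite_integral_continuous_1) auto
  then have "continuous_on I w"
    by (rule continuous_on_eq) (simp add: w_eq)
  with d(1) w_ge w_eq show ?thesis
    unfolding I_def f_def by (intro that[of d w]) auto
qed

text \<open>The integrand is positive. A general \<open>J\<close> serves closed and half-open
  intervals alike.\<close>

lemma solution_ge:
  assumes "solves_on a b g x0 J y" and "{0..t} \<subseteq> J" and "t \<in> J"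
  shows "x0 \<le> y t"
proof -
  have nonneg: "\<And>s. s \<in> {0..t} \<Longrightarrow> 0 \<le> y s + g s" and cont: "continuous_on {0..t} y"
    using assms continuous_on_subset by (auto simp: solves_on_def)
  have "0 \<le> integral {0..t} (\<lambda>s. a s * b (y s + g s))"
    using nonneg cont a_pos b_pos
    by (intro integral_nonneg integrable_continuous_interval integrand_cont) (auto simp: less_imp_le)
  then show ?thesis using assms by (simp add: solves_on_def)
qed

text \<open>A local solution started at time \<open>T\<close> from the value \<open>y T\<close> is
  glued to \<open>y\<close>; the integral from 0 splits at \<open>T\<close>.\<close>

lemma solution_extends:
  assumes sol: "solves_on a b g x0 {0..T} y" and "0 \<le> T" and "0 \<le> x0"
  obtains T' z where "T < T'" and "solves_on a b g x0 {0..T'} z" and "\<And>t. t \<in> {0..T} \<Longrightarrow> z t = y t"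
proof -
  have y_cont: "continuous_on {0..T} y" and y_nonneg: "\<And>t. t \<in> {0..T} \<Longrightarrow> 0 \<le> y t + g t"
    and y_eq: "\<And>t. t \<in> {0..T} \<Longrightarrow> y t = x0 + integral {0..t} (\<lambda>s. a s * b (y s + g s))"
    using sol unfolding solves_on_def by blast+
  have "0 \<le> y T" using solution_ge[OF sol, of T] assms by simp
  then obtain d w where d: "0 < d" and w_cont: "continuous_on {T..T + d} w"
    and w_ge: "\<And>t. t \<in> {T..T + d} \<Longrightarrow> y T \<le> w t"
    and w_eq: "\<And>t. t \<in> {T..T + d} \<Longrightarrow> w t = y T + integral {T..t} (\<lambda>s. a s * b (w s + g s))"
    using local_solution[OF \<open>0 \<le> T\<close>, of "y T"] by blast
  have [simp]: "w T = y T" using w_eq[of T] d by simp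
  define z where "z t = (if t \<le> T then y t else w t)" for t
  have z_w: "z t = w t" if "T \<le> t" for t using that by (auto simp: z_def)
  have "{0..T + d} = {0..T} \<union> {T..T + d}" using \<open>0 \<le> T\<close> d by auto
  moreover have "continuous_on ({0..T} \<union> {T..T + d}) z"
    unfolding z_def using y_cont w_cont by (intro continuous_on_cases) auto
  ultimately have z_cont: "continuous_on {0..T + d} z" by simp
  have z_nonneg: "0 \<le> z t + g t" if "t \<in> {0..T + d}" for t
    using that y_nonneg[of t] w_ge[of t] \<open>0 \<le> y T\<close> g_nonneg[of t] by (auto simp: z_def)
  have z_eq: "z t = x0 + integral {0..t} (\<lambda>s. a s * b (z s + g s))" if t: "t \<in> {0..T + d}" for t
  proof (cases "t \<le> T")
    case True
    have "integral {0..t} (\<lambda>s. a s * b (y s + g s)) = integral {0..t} (\<lambda>s. a s * b (z s + g s))"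
      using True by (intro integral_cong) (auto simp: z_def)
    then show ?thesis using y_eq[of t] t True by (simp add: z_def)
  next
    case False
    have int: "(\<lambda>s. a s * b (z s + g s)) integrable_on {0..t}"
      using t z_nonneg continuous_on_subset[OF z_cont]
      by (intro integrable_continuous_interval integrand_cont) auto
    have "z t = y T + integral {T..t} (\<lambda>s. a s * b (w s + g s))"
      using False w_eq[of t] t by (simp add: z_def)
    also have "integral {T..t} (\<lambda>s. a s * b (w s + g s)) = integral {T..t} (\<lambda>s. a s * b (z s + g s))"
      by (intro integral_cong) (auto simp: z_w)
    also have "y T = x0 + integral {0..T} (\<lambda>s. a s * b (y s + g s))"
      using y_eq[of T] \<open>0 \<le> T\<close> by simp
    also have "integral {0..T} (\<lambda>s. a s * b (y s + g s)) = integral {0..T} (\<lambda>s. a s * b (z s + g s))"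
      by (intro integral_cong) (auto simp: z_def)
    finally show ?thesis
      using Henstock_Kurzweil_Integration.integral_combine[OF \<open>0 \<le> T\<close> _ int] False by simp
  qed
  show ?thesis
  proof (rule that[of "T + d" z])
    show "solves_on a b g x0 {0..T + d} z"
      using z_cont z_nonneg z_eq by (simp add: solves_on_def)
  qed (use d in \<open>auto simp: z_def\<close>)
qed

text \<open>A bound on \<open>y\<close> bounds the integrand, which is therefore integrable up to
  \<open>T\<close>. Its indefinite integral is the continuous extension.\<close>

lemma bounded_solution_closes:
  assumes sol: "solves_on a b g x0 {0..<T} y" and "0 < T" and "0 \<le> x0"
    and bound: "\<And>t. t \<in> {0..<T} \<Longrightarrow> y t \<le> M"
  obtains z where "solves_on a b g x0 {0..T} z" and "\<And>t. t \<in> {0..<T} \<Longrightarrow> z t = y t"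
proof -
  define f where "f = (\<lambda>s. a s * b (y s + g s))"
  have y_nonneg: "\<And>t. t \<in> {0..<T} \<Longrightarrow> 0 \<le> y t + g t" and y_cont: "continuous_on {0..<T} y"
    and y_eq: "\<And>t. t \<in> {0..<T} \<Longrightarrow> y t = x0 + integral {0..t} f"
    using sol unfolding solves_on_def f_def by blast+
  obtain C where C: "\<And>s x. s \<in> {0..T} \<Longrightarrow> 0 \<le> x + g s \<Longrightarrow> x \<le> M \<Longrightarrow> \<bar>a s * b (x + g s)\<bar> \<le> C"
    by (rule integrand_bound[of T M]) (use \<open>0 < T\<close> in \<open>auto simp del: atLeastAtMost_iff\<close>)
  have "continuous_on {0..<T} f"
    unfolding f_def using y_cont y_nonneg by (intro integrand_cont) auto
  \<comment> \<open>Nothing is known of \<open>y\<close> at \<open>T\<close>, so integrability is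
    obtained on the half-open interval from measurability and boundedness. Adding the null set
    \<open>{T}\<close> does not affect it.\<close>
  then have "f \<in> borel_measurable (lebesgue_on {0..<T})"
    by (rule continuous_imp_measurable_on_sets_lebesgue) auto
  moreover have "(\<lambda>_. C) integrable_on {0..<T}"
    using integrable_const_ivl[of C 0 T]
    by (rule integrable_spike_set) (auto intro: negligible_subset[of "{T}"])
  moreover have "\<bar>f t\<bar> \<le> C" if "t \<in> {0..<T}" for t
    unfolding f_def using y_nonneg[OF that] bound[OF that] that by (intro C) auto
  ultimately have "f integrable_on {0..<T}"
    by (rule measurable_bounded_by_integrable_imp_integrable_real) auto
  then have f_int: "f integrable_on {0..T}"
    by (rule integrable_spike_set) (auto intro: negligible_subset[of "{T}"])
  define z where "z t = x0 + integral {0..t} f" for t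
  have z_y: "z t = y t" if "t \<in> {0..<T}" for t
    using y_eq[OF that] by (simp add: z_def)
  have z_cont: "continuous_on {0..T} z"
    unfolding z_def using f_int
    by (intro continuous_intros indefinite_integral_continuous_1)
  have z_nonneg: "0 \<le> z t + g t" if t: "t \<in> {0..T}" for t
  proof -
    have "x0 \<le> y s" if "s \<in> {0..<T}" for s
      using that by (intro solution_ge[OF sol _ that]) auto
    then have "x0 \<le> z s" if "s \<in> {0..<T}" for s
      using z_y[OF that] that by simp
    moreover have "closure {0..<T} = {0..T}" using \<open>0 < T\<close> by simp
    ultimately have "x0 \<le> z t"
      \<comment> \<open>At the endpoint the lower bound \<open>x0\<close> is inherited by
        continuity.\<close>
      using t z_cont by (intro continuous_ge_on_closure[of "{0..<T}" z t x0]) auto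
    then show ?thesis using t \<open>0 \<le> x0\<close> g_nonneg[of t] by simp
  qed
  have "z t = x0 + integral {0..t} (\<lambda>s. a s * b (z s + g s))" if t: "t \<in> {0..T}" for t
  proof -
    have "integral {0..t} f = integral {0..t} (\<lambda>s. a s * b (z s + g s))"
      \<comment> \<open>\<open>f\<close> is built from \<open>y\<close>, whose value at
        \<open>T\<close> may differ from \<open>z T\<close>; a single point does not change the
        integral.\<close>
      using t z_y by (intro integral_spike[of "{T}"]) (auto simp: f_def)
    then show ?thesis by (simp add: z_def)
  qed
  with z_cont z_nonneg have "solves_on a b g x0 {0..T} z"
    by (simp add: solves_on_def)
  with z_y show ?thesis by (rule that[rotated])
qed

section \<open>The comparison function \<open>A_tilde\<close> and the growth estimate\<close>

lemma A_tilde_integrand_cont: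
  assumes "0 < x0"
  shows "continuous_on {0..} (\<lambda>s. a s * b ((1 / x0) * g s + 1))"
proof (rule continuous_on_mult[OF a_cont], rule continuous_on_compose2[OF b_cont])
  show "continuous_on {0..} (\<lambda>s. (1 / x0) * g s + 1)"
    by (intro continuous_intros g_cont)
  show "(\<lambda>s. (1 / x0) * g s + 1) ` {0..} \<subseteq> {0..}"
    using assms g_nonneg by (simp add: image_subset_iff)
qed

lemma A_tilde_integrand_pos:
  assumes "0 < x0" and "0 \<le> s"
  shows "0 < a s * b ((1 / x0) * g s + 1)"
  using assms g_nonneg[of s] by (intro mult_pos_pos a_pos b_pos) simp_all

lemma A_tilde_cont:
  assumes "0 < x0"
  shows "continuous_on {0..u} (A_tilde a b g x0 c)"
  unfolding A_tilde_def
  by (intro continuous_on_mult_left indefinite_integral_continuous_1 integrable_continuous_interval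
      continuous_on_subset[OF A_tilde_integrand_cont[OF assms]]) auto

lemma A_tilde_strict_mono:
  assumes "0 < x0" and "0 < c"
  shows "strict_mono_on {0..} (A_tilde a b g x0 c)"
proof (rule strict_mono_onI)
  fix s t :: real
  assume "s \<in> {0..}" and "s < t"
  define f where "f = (\<lambda>s. a s * b ((1 / x0) * g s + 1))"
  have "integral {0..s} f < integral {0..t} f"
  \<comment> \<open>The open version is used because \<open>s\<close> may be 0, where no two-sided
    derivative is available.\<close>
  proof (rule DERIV_pos_imp_increasing_open[OF \<open>s < t\<close>])
    fix u assume "s < u" "u < t"
    then show "\<exists>y. ((\<lambda>s. integral {0..s} f) has_real_derivative y) (at u) \<and> 0 < y"
      using A_tilde_integrand_cont[OF assms(1)] A_tilde_integrand_pos[OF assms(1), of u] \<open>s \<in> {0..}\<close>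
      by (intro exI[of _ "f u"] conjI integral_has_real_derivative_atLeast) (auto simp: f_def)
  next
    have "continuous_on {0..t} (\<lambda>s. integral {0..s} f)"
      unfolding f_def
      by (intro indefinite_integral_continuous_1 integrable_continuous_interval
          continuous_on_subset[OF A_tilde_integrand_cont[OF assms(1)]]) auto
    then show "continuous_on {s..t} (\<lambda>s. integral {0..s} f)"
      using \<open>s \<in> {0..}\<close> by (auto intro: continuous_on_subset)
  qed
  then show "A_tilde a b g x0 c s < A_tilde a b g x0 c t"
    using \<open>0 < c\<close> by (simp add: A_tilde_def f_def)
qed

text \<open>Separation of variables: the derivative of \<open>H (y s)\<close> is
  \<open>f s / b (y s)\<close>, which is at most \<open>c * h s\<close>, and both sides are
  integrated. Since \<open>H\<close> integrates from 0, every \<open>y s \<ge> x0 > 0\<close> is a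
  point of two-sided differentiability, as the chain rule requires.\<close>

lemma solution_estimate:
  assumes sol: "solves_on a b g x0 {0..t} y" and "0 \<le> t" and "0 < x0" and "0 < c"
    and submult: "\<And>x y. 0 \<le> x \<Longrightarrow> 0 \<le> y \<Longrightarrow> b (x * y) \<le> c * b x * b y"
  shows "integral {0..y t} (\<lambda>s. 1 / b s) - integral {0..x0} (\<lambda>s. 1 / b s) \<le> A_tilde a b g x0 c t"
proof -
  define H where "H u = integral {0..u} (\<lambda>s. 1 / b s)" for u
  define f where "f = (\<lambda>s. a s * b (y s + g s))"
  define h where "h = (\<lambda>s. a s * b ((1 / x0) * g s + 1))"
  have y_cont: "continuous_on {0..t} y" and y_nonneg: "\<And>s. s \<in> {0..t} \<Longrightarrow> 0 \<le> y s + g s"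
    and y_eq: "\<And>s. s \<in> {0..t} \<Longrightarrow> y s = x0 + integral {0..s} f"
    using sol unfolding solves_on_def f_def by blast+
  have y_ge: "x0 \<le> y s" if "s \<in> {0..t}" for s
    using solution_ge[OF sol _ that] that by auto
  have inv_cont: "continuous_on {0..} (\<lambda>s. 1 / b s)"
    using b_cont b_pos by (intro continuous_intros) (auto simp: less_imp_neq[THEN not_sym])
  have f_cont: "continuous_on {0..t} f"
    unfolding f_def using y_cont y_nonneg by (intro integrand_cont) auto
  have y_deriv: "(y has_real_derivative f s) (at s within {0..t})" if s: "s \<in> {0..t}" for s
  proof -
    have "((\<lambda>s. x0 + integral {0..s} f) has_real_derivative f s) (at s within {0..t})"
      using integral_has_real_derivative[OF f_cont s] by (auto intro!: derivative_eq_intros)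
    then show ?thesis
      by (rule has_field_derivative_transform_within[OF _ zero_less_one s]) (simp add: y_eq)
  qed
  have "((\<lambda>s. H (y s)) has_real_derivative (1 / b (y s) * f s)) (at s within {0..t})"
    if s: "s \<in> {0..t}" for s
  proof (rule DERIV_chain2[OF _ y_deriv[OF s]])
    show "(H has_real_derivative 1 / b (y s)) (at (y s))"
      unfolding H_def using inv_cont y_ge[OF s] \<open>0 < x0\<close>
      by (intro integral_has_real_derivative_atLeast) auto
  qed
  then have "((\<lambda>s. 1 / b (y s) * f s) has_integral H (y t) - H (y 0)) {0..t}"
    using \<open>0 \<le> t\<close> by (intro fundamental_theorem_of_calculus)
      (auto simp: has_real_derivative_iff_has_vector_derivative)
  moreover have "h integrable_on {0..t}"
    unfolding h_def
    by (intro integrable_continuous_interval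
        continuous_on_subset[OF A_tilde_integrand_cont[OF \<open>0 < x0\<close>]]) auto
  then have "((\<lambda>s. c * h s) has_integral c * integral {0..t} h) {0..t}"
    by (intro has_integral_mult_right integrable_integral)
  moreover have "1 / b (y s) * f s \<le> c * h s" if s: "s \<in> {0..t}" for s
  proof -
    have y: "0 < y s" using y_ge[OF s] \<open>0 < x0\<close> by simp
    have g: "0 \<le> g s" and a: "0 < a s" using s g_nonneg a_pos by auto
    \<comment> \<open>The sum becomes a product, ready for sub-multiplicativity:
      \<open>y s / x0 \<ge> 1\<close>.\<close>
    have "y s + g s \<le> y s * ((1 / x0) * g s + 1)"
      using mult_right_mono[OF y_ge[OF s] g] \<open>0 < x0\<close> by (simp add: field_simps)
    then have "b (y s + g s) \<le> b (y s * ((1 / x0) * g s + 1))"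
      using y g by (intro b_le) auto
    also have "\<dots> \<le> c * b (y s) * b ((1 / x0) * g s + 1)"
      using y g \<open>0 < x0\<close> by (intro submult) auto
    finally have "a s * b (y s + g s) \<le> a s * (c * b (y s) * b ((1 / x0) * g s + 1))"
      using a by (intro mult_left_mono) auto
    then show ?thesis
      using b_pos[of "y s"] y by (simp add: f_def h_def field_simps)
  qed
  ultimately have "H (y t) - H (y 0) \<le> c * integral {0..t} h"
    by (rule has_integral_le)
  moreover have "y 0 = x0" using y_eq[of 0] \<open>0 \<le> t\<close> by simp
  ultimately show ?thesis
    by (simp add: H_def A_tilde_def h_def)
qed

lemma solution_bounded:
  assumes sol: "solves_on a b g x0 {0..<T} y" and "0 < T" and "0 < x0" and "0 < c"
    and submult: "\<And>x y. 0 \<le> x \<Longrightarrow> 0 \<le> y \<Longrightarrow> b (x * y) \<le> c * b x * b y"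
    and less: "ereal (A_tilde a b g x0 c T) < B_infinity b x0"
  obtains M where "\<And>t. t \<in> {0..<T} \<Longrightarrow> y t \<le> M"
proof -
  define H where "H u = integral {0..u} (\<lambda>s. 1 / b s)" for u
  \<comment> \<open>Without such an \<open>M\<close>, \<open>B_infinity_le\<close> would bound
    \<open>B_infinity b x0\<close> by \<open>A_tilde a b g x0 c T\<close>. A solution exceeding
    \<open>M\<close> would then violate the growth estimate.\<close>
  obtain M where M: "x0 \<le> M" "A_tilde a b g x0 c T < H M - H x0"
    using B_infinity_le[OF b_cont b_pos \<open>0 < x0\<close>, of "A_tilde a b g x0 c T"] less
    unfolding H_def by (meson not_le)
  have inv_int: "(\<lambda>s. 1 / b s) integrable_on {0..u}" for u
    using continuous_on_subset[OF b_cont, of "{0..u}"] b_pos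
    by (intro integrable_continuous_interval continuous_intros)
      (auto simp: less_imp_neq[THEN not_sym])
  show ?thesis
  proof (rule that[of M], rule ccontr)
    fix t assume t: "t \<in> {0..<T}" and "\<not> y t \<le> M"
    then have "H M \<le> H (y t)"
      unfolding H_def using inv_int b_pos
      by (intro integral_subset_le) (auto simp: less_imp_le)
    moreover have "H (y t) - H x0 \<le> A_tilde a b g x0 c t"
      unfolding H_def using t assms
      by (intro solution_estimate solves_on_subset[OF sol]) auto
    moreover have "A_tilde a b g x0 c t \<le> A_tilde a b g x0 c T"
      using strict_mono_onD[OF A_tilde_strict_mono[OF \<open>0 < x0\<close> \<open>0 < c\<close>], of t T] t by simp
    ultimately show False using M by simp
  qed
qed

end

section \<open>Maximality against boundedness up to a finite time\<close>

theorem proposition8: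
  fixes a b g :: "real \<Rightarrow> real" and x0 c :: real and Y :: "real \<Rightarrow> ereal"
  assumes "continuous_on {0..} a" and "\<And>t. 0 \<le> t \<Longrightarrow> 0 < a t"
    and "continuous_on {0..} b" and "\<And>x. 0 \<le> x \<Longrightarrow> 0 < b x"
    and "mono_on {0..} b"
    and "continuous_on {0..} g" and "\<And>t. 0 \<le> t \<Longrightarrow> 0 \<le> g t"
    and "0 < x0"
    and "0 < c"
    and "\<And>x y. 0 \<le> x \<Longrightarrow> 0 \<le> y \<Longrightarrow> b (x * y) \<le> c * b x * b y"
    and "maximal_solution a b g x0 Y"
  shows "extended_inverse (A_tilde a b g x0 c) (B_infinity b x0) \<le> explosion_time Y"
proof -
  interpret growth_coefficients a b g
    using assms(1-7) by unfold_locales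
  obtain T y where "0 < T" and sol: "solves_on a b g x0 (upto_time T) y"
    and maximal: "\<And>T' z. T < T' \<Longrightarrow> solves_on a b g x0 (upto_time T') z \<Longrightarrow>
      \<not> (\<forall>t\<in>upto_time T. z t = y t)"
    and Y: "\<And>t. 0 \<le> t \<Longrightarrow> Y t = (if ereal t < T then ereal (y t) else \<infinity>)"
    using assms(11) unfolding maximal_solution_def by blast
  have expl: "explosion_time Y = T"
    using \<open>0 < T\<close> Y by (rule explosion_time_eq)
  show ?thesis
  proof (rule ccontr)
    assume "\<not> ?thesis"
    then have less: "T < extended_inverse (A_tilde a b g x0 c) (B_infinity b x0)"
      by (simp add: expl)
    \<comment> \<open>Lying strictly below another extended real excludes an infinite
      \<open>T\<close>.\<close>
    with \<open>0 < T\<close> obtain r where r: "T = ereal r" "0 < r" by (cases T) auto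
    note sol = sol[unfolded r upto_time_ereal]
    have "ereal (A_tilde a b g x0 c r) < B_infinity b x0"
    proof (rule less_of_less_extended_inverse[of "A_tilde a b g x0 c"])
      show "continuous_on {0..u} (A_tilde a b g x0 c)" for u
        using \<open>0 < x0\<close> by (rule A_tilde_cont)
      show "strict_mono_on {0..} (A_tilde a b g x0 c)"
        using \<open>0 < x0\<close> \<open>0 < c\<close> by (rule A_tilde_strict_mono)
      show "A_tilde a b g x0 c 0 = 0" by (simp add: A_tilde_def)
      show "0 \<le> B_infinity b x0" by (simp add: B_infinity_def)
      show "0 \<le> r" using r by simp
      show "ereal r < extended_inverse (A_tilde a b g x0 c) (B_infinity b x0)"
        using less r by simp
    qed
    then obtain M where "\<And>t. t \<in> {0..<r} \<Longrightarrow> y t \<le> M"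
      using solution_bounded[OF sol \<open>0 < r\<close> \<open>0 < x0\<close> \<open>0 < c\<close> assms(10)] by blast
    then obtain z where z: "solves_on a b g x0 {0..r} z" "\<And>t. t \<in> {0..<r} \<Longrightarrow> z t = y t"
      using bounded_solution_closes[OF sol \<open>0 < r\<close>] \<open>0 < x0\<close> by (metis less_imp_le)
    then obtain r' v where v: "r < r'" "solves_on a b g x0 {0..r'} v" "\<And>t. t \<in> {0..r} \<Longrightarrow> v t = z t"
      using solution_extends[OF z(1)] \<open>0 < r\<close> \<open>0 < x0\<close> by (metis less_imp_le)
    \<comment> \<open>Maximality speaks of half-open intervals, so \<open>v\<close> is restricted;
      \<open>r < r'\<close> still makes this a proper extension.\<close>
    then have "solves_on a b g x0 (upto_time (ereal r')) v"
      by (auto intro: solves_on_subset)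
    moreover have "T < ereal r'" using v(1) r by simp
    ultimately have "\<not> (\<forall>t\<in>upto_time T. v t = y t)"
      by (rule maximal[rotated])
    moreover have "v t = y t" if "t \<in> upto_time T" for t
    proof -
      have t: "t \<in> {0..<r}" using that unfolding r upto_time_ereal .
      then have "v t = z t" by (intro v(3)) auto
      then show ?thesis using z(2)[OF t] by (rule trans)
    qed
    ultimately show False by blast
  qed
qed

end
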